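(* Let $p \in \mathbb{N}$, let $a_1, \dots, a_p$ be distinct complex numbers, let $c_1, \dots, c_p$ be positive integers, and put $W(z) = \prod_{j=1}^p (z-a_j)^{c_j}$, a polynomial of degree $c = \sum_{j=1}^p c_j$. Let $n \ge 0$ be an integer and let $P_n$ be a monic polynomial of degree $n$. Then the following properties are equivalent. (a) $P_n$ is the planar orthogonal polynomial of degree $n$ on $\mathbb{C}$ with respect to the measure $\mu_W(\mathrm{d}z) = \frac{1}{\pi} |W(z)|^2 e^{-|z|^2}\, \mathrm{Leb}(\mathrm{d}z)$, i.e. $$\int_{\mathbb{C}} P_n(z)\, \overline{z}^k \, \mu_W(\mathrm{d}z) = 0, \qquad k = 0, 1, \dots, n-1.$$ (b) $P_n$ satisfies $$\frac{1}{2\pi i} \oint_{\gamma} P_n(z) W(z) \phi_k(z)\, \mathrm{d}z = 0, \qquad k=0,1,\dots,n-1,$$ where $\gamma$ is a closed contour around the origin and $$\phi_k(z) = \int_0^{\overline{z}\times\infty} W^*(u)\, u^k e^{-uz}\, \mathrm{d}u, \qquad z \in \mathbb{C}\setminus\{0\},$$ the path of integration going from $0$ to $\infty$ along the ray $\arg u = \arg \overline{z}$. (c) One has $$W^*(\mathscr{D}_z)\left[ P_n(z) W(z) \right] = O(z^n) \quad \text{as } z \to 0.$$ (d) There exist polynomials $Q_1, \dots, Q_p$ with $\deg Q_j \le c_j - 1$ for $j = 1, \dots, p$, such that $$P_n(z) W(z) + \sum_{j=1}^p Q_j(z)\, e^{\overline{a_j} z} = O\big(z^{n+c}\big) \quad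 \text{as } z \to 0.$$
   Context: $\mathrm{Leb}$ denotes the Lebesgue measure on $\mathbb{C}$, identified with $\mathbb{R}^2$. The conjugate polynomial of $W$ is $W^*(z) = \overline{W(\overline{z})} = \prod_{j=1}^p (z - \overline{a_j})^{c_j}$. $\mathscr{D}_z$ denotes the derivative operator $\mathrm{d}/\mathrm{d}z$, and $W^*(\mathscr{D}_z) = \prod_{j=1}^p (\mathscr{D}_z - \overline{a_j})^{c_j}$ is the corresponding constant-coefficient linear differential operator. A closed contour around the origin means a simple closed contour in $\mathbb{C}\setminus\{0\}$ going around the origin once in the counterclockwise direction. *)

theory Defs
  imports
    "HOL-Complex_Analysis.Complex_Analysis"
    "HOL-Computational_Algebra.Computational_Algebra"
    "HOL-Library.Landau_Symbols"
begin

definition conj_poly :: "complex poly \<Rightarrow> complex poly" where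
  "conj_poly q = map_poly cnj q"

lemma poly_conj_poly: "poly (conj_poly q) z = cnj (poly q (cnj z))"
  unfolding conj_poly_def by (induction q) (auto simp: map_poly_pCons)

lemma conj_poly_mult: "conj_poly (q * r) = conj_poly q * conj_poly r"
  by (rule poly_eq_poly_eq_iff[THEN iffD1]) (auto simp: poly_conj_poly fun_eq_iff)

lemma conj_poly_prod:
  "conj_poly (\<Prod>j\<in>J. [:- a j, 1:] ^ c j) = (\<Prod>j\<in>J. [:- cnj (a j), 1:] ^ c j)"
  by (rule poly_eq_poly_eq_iff[THEN iffD1])
     (auto simp: poly_conj_poly poly_prod poly_power fun_eq_iff)

text \<open>On \<^typ>\<open>complex\<close>, \<^const>\<open>lborel\<close> is the Lebesgue measure of the plane.\<close>

definition planar_measure :: "complex poly \<Rightarrow> complex measure" where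
  "planar_measure W =
     density lborel (\<lambda>z. ennreal (1 / pi * (cmod (poly W z))\<^sup>2 * exp (- (cmod z)\<^sup>2)))"

definition planar_orthogonal :: "complex measure \<Rightarrow> complex poly \<Rightarrow> bool" where
  "planar_orthogonal M P \<longleftrightarrow> (\<forall>k<degree P. (LINT z|M. poly P z * cnj z ^ k) = 0)"

text \<open>
  The integral of \<open>f\<close> from \<open>0\<close> to \<open>\<infinity>\<close> along the ray through \<open>v \<noteq> 0\<close>, which is parametrized
  by arc length: \<open>u = r v / |v|\<close>, \<open>r \<ge> 0\<close>.
\<close>

definition ray_integral :: "complex \<Rightarrow> (complex \<Rightarrow> complex) \<Rightarrow> complex" where
  "ray_integral v f = (LBINT r:{0..}. f (of_real r * sgn v) * sgn v)"

definition phi :: "complex poly \<Rightarrow> nat \<Rightarrow> complex \<Rightarrow> complex" where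
  "phi W k z = ray_integral (cnj z) (\<lambda>u. poly (conj_poly W) u * u ^ k * exp (- u * z))"

definition contour_around_origin :: "(real \<Rightarrow> complex) \<Rightarrow> bool" where
  "contour_around_origin \<gamma> \<longleftrightarrow>
     valid_path \<gamma> \<and> simple_path \<gamma> \<and> pathfinish \<gamma> = pathstart \<gamma> \<and>
     0 \<notin> path_image \<gamma> \<and> winding_number \<gamma> 0 = 1"

text \<open>The differential operator \<open>q(d/dz)\<close>.\<close>

definition poly_diffop :: "complex poly \<Rightarrow> (complex \<Rightarrow> complex) \<Rightarrow> complex \<Rightarrow> complex" where
  "poly_diffop q f z = (\<Sum>i\<le>degree q. coeff q i * (deriv ^^ i) f z)"

text \<open>On entire functions, \<^const>\<open>poly_diffop\<close> turns a factorization of the polynomial into a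
  composition of first-order operators.\<close>

lemma poly_diffop_altdef:
  assumes "degree q \<le> N"
  shows "poly_diffop q f z = (\<Sum>i\<le>N. coeff q i * (deriv ^^ i) f z)"
  unfolding poly_diffop_def
  by (rule sum.mono_neutral_left) (use assms in \<open>auto simp: coeff_eq_0\<close>)

lemma poly_diffop_linear_factor:
  assumes "f holomorphic_on UNIV"
  shows "poly_diffop ([:- b, 1:] * q) f z = deriv (poly_diffop q f) z - b * poly_diffop q f z"
proof -
  define N where "N = degree q"
  have D: "((deriv ^^ i) f has_field_derivative (deriv ^^ Suc i) f z) (at z)" for i
    using holomorphic_derivI[OF holomorphic_higher_deriv[OF assms open_UNIV]] by simp
  have diffop_eq: "poly_diffop q f = (\<lambda>z. \<Sum>i\<le>N. coeff q i * (deriv ^^ i) f z)"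
    by (simp add: fun_eq_iff poly_diffop_def N_def)
  have "(poly_diffop q f has_field_derivative (\<Sum>i\<le>N. coeff q i * (deriv ^^ Suc i) f z)) (at z)"
    unfolding diffop_eq by (intro DERIV_sum DERIV_cmult D)
  then have der: "deriv (poly_diffop q f) z = (\<Sum>i\<le>N. coeff q i * (deriv ^^ Suc i) f z)"
    by (rule DERIV_imp_deriv)
  have eq: "[:- b, 1:] * q = pCons 0 q - smult b q"
    by simp
  have deg: "degree ([:- b, 1:] * q) \<le> Suc N"
    using degree_mult_le[of "[:- b, 1:]" q] by (simp add: N_def)
  have "poly_diffop ([:- b, 1:] * q) f z
      = (\<Sum>i\<le>Suc N. coeff (pCons 0 q) i * (deriv ^^ i) f z)
        - b * (\<Sum>i\<le>Suc N. coeff q i * (deriv ^^ i) f z)"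
    unfolding poly_diffop_altdef[OF deg] unfolding eq
    by (simp only: coeff_diff coeff_smult left_diff_distrib sum_subtractf sum_distrib_left mult.assoc)
  also have "(\<Sum>i\<le>Suc N. coeff (pCons 0 q) i * (deriv ^^ i) f z) = deriv (poly_diffop q f) z"
    unfolding der by (subst sum.atMost_Suc_shift) (simp del: funpow.simps)
  also have "(\<Sum>i\<le>Suc N. coeff q i * (deriv ^^ i) f z) = poly_diffop q f z"
    by (rule poly_diffop_altdef[symmetric]) (simp add: N_def)
  finally show ?thesis .
qed

end

theory Submission
  imports Defs "HOL-Probability.Distributions"
begin

text \<open>
  Put \<open>f = P W\<close>. All conditions say that \<open>f\<close> is orthogonal to \<open>z\<^sup>k W\<close> for \<open>k < n\<close> in the Fischer inner product,
  which pairs \<open>z\<^sup>i\<close> with \<open>z\<^sup>j\<close> to \<open>j!\<close> if \<open>i = j\<close> and to \<open>0\<close> otherwise. This inner product has three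
  realizations. It is the \<open>L\<^sup>2\<close> product of the normalized Gaussian, for which monomials are orthogonal
  with squared norms \<open>j!\<close>; that gives the planar orthogonality (\<open>planar_moment\<close>). It is a contour
  integral, since the Laplace transform of \<open>u\<^sup>j\<close> is \<open>j! / z\<^bsup>j+1\<^esup>\<close>; that gives the contour condition
  (\<open>contour_moment\<close>). Finally, differentiation is adjoint to multiplication by the variable, so the
  pairing with \<open>z\<^sup>k W\<close> is \<open>k!\<close> times the \<open>k\<close>-th Taylor coefficient of \<open>W*(d/dz) f\<close>; that gives the differential
  condition (\<open>fps_diffop_nth_fps_of_poly\<close>).

  The approximation by exponential polynomials is reached from the differential condition. The kernel of
  \<open>W*(d/dz)\<close> consists of the sums \<open>(\<Sum>j. Q\<^sub>j(z) e\<^bsup>b\<^sub>j z\<^esup>)\<close>, where \<open>b\<^sub>j = cnj a\<^sub>j\<close>,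
  with the prescribed degree bounds, and inverting an operator of order \<open>c\<close> with zero initial data
  raises the order of vanishing by \<open>c\<close>. Hence \<open>W*(d/dz) f\<close> vanishes to order \<open>n\<close> exactly if some kernel element corrects \<open>f\<close> to order \<open>n + c\<close>. The lemma
  \<open>fps_diffop_vanishes_iff\<close> proves this one linear factor at a time on formal power series.
\<close>

unbundle no vec_syntax

section \<open>Fischer moments\<close>

text \<open>
  The Fischer inner product of polynomials is \<open>\<langle>f, g\<rangle> = (\<Sum>m. m! * f\<^sub>m * cnj g\<^sub>m)\<close>. For \<open>q = conj_poly g\<close> the
  value below is \<open>\<langle>f, z\<^sup>k g\<rangle>\<close>; taking \<open>q\<close> itself as the argument keeps the expression bilinear and
  free of conjugation, so that it makes sense over any field of
  characteristic zero.
\<close>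

definition fischer_moment :: "'a::field_char_0 poly \<Rightarrow> 'a poly \<Rightarrow> nat \<Rightarrow> 'a" where
  "fischer_moment q f k = (\<Sum>m\<le>degree q. coeff q m * fact (m + k) * coeff f (m + k))"

text \<open>
  The shape in which the Fischer moment comes out of an integral over a product of two expanded
  polynomials: the integral of a pair of monomials contributes a factorial on the diagonal only.
\<close>

lemma double_sum_fischer_moment:
  "(\<Sum>m\<le>degree q. \<Sum>i\<le>degree f. coeff q m * coeff f i * (if i = m + k then fact (m + k) else 0))
    = fischer_moment q f k"
proof -
  have "(\<Sum>i\<le>degree f. coeff q m * coeff f i * (if i = m + k then fact (m + k) else 0))
      = coeff q m * fact (m + k) * coeff f (m + k)" for m
  proof -
    have "(\<Sum>i\<le>degree f. coeff q m * coeff f i * (if i = m + k then fact (m + k) else 0))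
        = (\<Sum>i\<le>degree f. if i = m + k then coeff q m * fact (m + k) * coeff f (m + k) else 0)"
      by (intro sum.cong) auto
    then show ?thesis
      by (simp add: coeff_eq_0)
  qed
  then show ?thesis
    by (simp add: fischer_moment_def)
qed

section \<open>Gaussian moments in the plane\<close>

lemma nn_integral_lborel_translation:
  fixes f :: "'a::euclidean_space \<Rightarrow> ennreal"
  assumes [measurable]: "f \<in> borel_measurable borel"
  shows "(\<integral>\<^sup>+x. f (t + x) \<partial>lborel) = (\<integral>\<^sup>+x. f x \<partial>lborel)"
  by (subst (2) lborel_distr_plus[of t, symmetric]) (simp add: nn_integral_distr)

text \<open>
  Invariance under rotations follows from translation invariance alone, by the Fubini argument that
  proves uniqueness of Haar measure. Multiply \<open>\<integral> f (T x) dx\<close> by the volume \<open>\<integral> g\<close> of the unit ball.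
  Translating once in each variable moves \<open>T\<close> from \<open>f\<close> to \<open>g\<close>, and for \<open>g\<close> it is harmless because \<open>T\<close>
  maps balls to balls of the same radius. The positive finite volume is then cancelled.
\<close>

lemma nn_integral_lborel_orthogonal:
  fixes f :: "'a::euclidean_space \<Rightarrow> ennreal"
    and T :: "'a \<Rightarrow> 'a"
  assumes [measurable]: "f \<in> borel_measurable borel" and T: "orthogonal_transformation T"
  shows "(\<integral>\<^sup>+x. f (T x) \<partial>lborel) = (\<integral>\<^sup>+x. f x \<partial>lborel)"
proof -
  define S where "S = inv T"
  define g :: "'a \<Rightarrow> ennreal" where "g = indicator (ball 0 1)"
  define \<kappa> where "\<kappa> = ennreal (unit_ball_vol DIM('a))"
  have \<kappa>_pos: "\<kappa> \<noteq> 0" and \<kappa>_finite: "\<kappa> < \<infinity>"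
    using unit_ball_vol_pos[OF of_nat_0_le_iff, of "DIM('a)"] by (simp_all add: \<kappa>_def not_le del: unit_ball_vol_pos)
  have lin: "linear T"
    by (rule orthogonal_transformation_linear[OF T])
  have [measurable]: "T \<in> borel_measurable borel"
    by (intro borel_measurable_continuous_onI linear_continuous_on lin linear_conv_bounded_linear[THEN iffD1])
  have [measurable]: "g \<in> borel_measurable borel"
    unfolding g_def by (rule borel_measurable_indicator) simp
  have TS: "T (S y) = y" for y
    using orthogonal_transformation_surj[OF T] by (simp add: S_def surj_f_inv_f)
  have norm_T: "norm (T x) = norm x" for x
    using T by (rule orthogonal_transformation_norm)
  have ball: "(\<integral>\<^sup>+x. g (y - T x) \<partial>lborel) = \<kappa>" for y
  proof -
    have "g (y - T x) = indicator (ball (S y) 1) x" for x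
    proof -
      have "norm (y - T x) = norm (T (S y - x))"
        by (simp add: linear_diff[OF lin] TS)
      then show ?thesis
        by (simp add: g_def indicator_def norm_T dist_norm norm_minus_commute[of "T x" y])
    qed
    then show ?thesis
      by (simp add: emeasure_ball \<kappa>_def)
  qed
  have g_int: "(\<integral>\<^sup>+y. g y \<partial>lborel) = \<kappa>"
    by (simp add: g_def emeasure_ball \<kappa>_def)
  have "(\<integral>\<^sup>+x. f (T x) \<partial>lborel) * \<kappa> = (\<integral>\<^sup>+y. (\<integral>\<^sup>+x. f (T x) \<partial>lborel) * g y \<partial>lborel)"
    by (simp add: nn_integral_cmult g_int)
  also have "\<dots> = (\<integral>\<^sup>+y. (\<integral>\<^sup>+x. f (T x + y) * g y \<partial>lborel) \<partial>lborel)"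
  proof (rule nn_integral_cong)
    fix y
    have "(\<integral>\<^sup>+x. f (T x) \<partial>lborel) = (\<integral>\<^sup>+x. f (T (S y + x)) \<partial>lborel)"
      by (rule nn_integral_lborel_translation[symmetric]) simp
    then show "(\<integral>\<^sup>+x. f (T x) \<partial>lborel) * g y = (\<integral>\<^sup>+x. f (T x + y) * g y \<partial>lborel)"
      by (simp add: linear_add[OF lin] TS nn_integral_multc add.commute)
  qed
  also have "\<dots> = (\<integral>\<^sup>+x. (\<integral>\<^sup>+y. f (T x + y) * g y \<partial>lborel) \<partial>lborel)"
    by (rule lborel_pair.Fubini') measurable
  also have "\<dots> = (\<integral>\<^sup>+x. (\<integral>\<^sup>+y. f y * g (y - T x) \<partial>lborel) \<partial>lborel)"
  proof (rule nn_integral_cong)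
    fix x
    show "(\<integral>\<^sup>+y. f (T x + y) * g y \<partial>lborel) = (\<integral>\<^sup>+y. f y * g (y - T x) \<partial>lborel)"
      using nn_integral_lborel_translation[of "\<lambda>y. f y * g (y - T x)" "T x"] by simp
  qed
  also have "\<dots> = (\<integral>\<^sup>+y. (\<integral>\<^sup>+x. f y * g (y - T x) \<partial>lborel) \<partial>lborel)"
    by (rule lborel_pair.Fubini') measurable
  also have "\<dots> = (\<integral>\<^sup>+y. f y \<partial>lborel) * \<kappa>"
    by (simp add: nn_integral_cmult ball nn_integral_multc)
  finally show ?thesis
    by (metis \<kappa>_finite \<kappa>_pos ennreal_mult_divide_eq infinity_ennreal_def less_irrefl)
qed

lemma lborel_distr_orthogonal:
  fixes T :: "'a::euclidean_space \<Rightarrow> 'a"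
  assumes T: "orthogonal_transformation T"
  shows "distr lborel borel T = lborel"
proof (rule measure_eqI)
  fix A assume "A \<in> sets (distr lborel borel T)"
  then have A [measurable]: "A \<in> sets borel"
    by simp
  have [measurable]: "T \<in> borel_measurable borel"
    using orthogonal_transformation_linear[OF T]
    by (intro borel_measurable_continuous_onI linear_continuous_on linear_conv_bounded_linear[THEN iffD1])
  have "emeasure (distr lborel borel T) A = (\<integral>\<^sup>+x. indicator A (T x) \<partial>lborel)"
    by (simp add: nn_integral_distr flip: nn_integral_indicator)
  also have "\<dots> = emeasure lborel A"
    using nn_integral_lborel_orthogonal[OF _ T, of "indicator A"] by simp
  finally show "emeasure (distr lborel borel T) A = emeasure lborel A" .
qed simp

lemma orthogonal_transformation_unimodular:
  assumes "cmod w = 1"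
  shows "orthogonal_transformation ((*) w)"
  using assms by (auto simp: orthogonal_transformation norm_mult intro!: linearI algebra_simps)

text \<open>
  Polar coordinates for radial functions. Both measures give the half-line up to \<open>x \<ge> 0\<close> the area
  \<open>\<pi> x\<close> of the disc of radius \<open>\<surd>x\<close>.
\<close>

lemma lborel_distr_norm_square:
  "distr lborel borel (\<lambda>z::complex. (cmod z)\<^sup>2) = density lborel (\<lambda>t. ennreal (pi * indicator {0..} t))"
    (is "?M = ?N")
proof (rule measure_eqI_generator_eq[where E = "range atMost" and \<Omega> = UNIV and A = "\<lambda>n. {..real n}"])
  have M: "emeasure ?M {..x} = ennreal (pi * max 0 x)" for x
  proof -
    have "emeasure ?M {..x} = emeasure lborel {z::complex. (cmod z)\<^sup>2 \<le> x}"
      by (subst emeasure_distr) (auto simp: vimage_def)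
    also have "{z::complex. (cmod z)\<^sup>2 \<le> x} = (if x \<ge> 0 then cball 0 (sqrt x) else {})"
      by (auto simp: real_le_rsqrt dist_norm real_sqrt_le_iff intro: real_le_rsqrt)
        (metis norm_ge_zero power_mono real_sqrt_pow2, smt (verit) zero_le_power2)
    also have "emeasure lborel \<dots> = ennreal (pi * max 0 x)"
      by (simp add: emeasure_cball unit_ball_vol_2)
    finally show ?thesis .
  qed
  have N: "emeasure ?N {..x} = ennreal (pi * max 0 x)" for x
  proof -
    have "emeasure ?N {..x} = (\<integral>\<^sup>+t. ennreal pi * indicator {0..x} t \<partial>lborel)"
      by (subst emeasure_density) (auto intro!: nn_integral_cong simp: indicator_def)
    also have "\<dots> = ennreal (pi * max 0 x)"
      by (simp add: nn_integral_cmult ennreal_mult' max_def)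
    finally show ?thesis .
  qed
  show "emeasure ?M X = emeasure ?N X" if "X \<in> range atMost" for X
    using that by (auto simp: M N)
  show "emeasure ?M {..real n} \<noteq> \<infinity>" for n
    by (simp add: M)
  show "sets ?M = sigma_sets UNIV (range atMost)" "sets ?N = sigma_sets UNIV (range atMost)"
    by (simp_all add: borel_eq_atMost)
  show "Int_stable (range (atMost :: real \<Rightarrow> _))"
    by (auto simp: Int_stable_def)
  show "(\<Union>n. {..real n}) = UNIV"
    by (auto intro: real_arch_simple)
qed auto

lemma has_bochner_integral_power_exp:
  fixes l :: real
  assumes "l > 0"
  shows "has_bochner_integral lborel (\<lambda>r. indicator {0..} r * (r ^ j * exp (- l * r))) (fact j / l ^ Suc j)"
proof -
  have "has_bochner_integral lborel (\<lambda>x. erlang_density 0 l x * x ^ j) (fact j / l ^ j)"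
    using nn_integral_erlang_ith_moment[OF assms, of 0 j] assms
    by (intro has_bochner_integral_nn_integral) (auto simp: erlang_density_def intro!: AE_I2)
  then have "has_bochner_integral lborel (\<lambda>x. erlang_density 0 l x * x ^ j / l) (fact j / l ^ j / l)"
    by (rule has_bochner_integral_divide_zero)
  then show ?thesis
    using assms
    by (elim has_bochner_integral_cong[THEN iffD1, rotated -1])
      (auto simp: erlang_density_def indicator_def)
qed

lemma has_bochner_integral_radial_gaussian:
  "has_bochner_integral lborel (\<lambda>z::complex. ((cmod z)\<^sup>2) ^ k * exp (- (cmod z)\<^sup>2)) (pi * fact k)"
proof -
  have "has_bochner_integral lborel (\<lambda>t. pi * (indicator {0..} t * (t ^ k * exp (- 1 * t)))) (pi * (fact k / 1 ^ Suc k))"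
    by (intro has_bochner_integral_mult_right has_bochner_integral_power_exp) simp
  then have "has_bochner_integral (density lborel (\<lambda>t. ennreal (pi * indicator {0..} t)))
      (\<lambda>t. t ^ k * exp (- t)) (pi * fact k)"
    by (intro has_bochner_integral_density) (auto simp: mult.assoc)
  then show ?thesis
    unfolding lborel_distr_norm_square[symmetric]
    by (simp add: has_bochner_integral_iff integrable_distr_eq integral_distr)
qed

text \<open>
  Odd powers of the modulus are not powers of \<open>|z|\<^sup>2\<close>, hence the crude bound
  \<open>x\<^sup>m \<le> 1 + (x\<^sup>2)\<^sup>m\<close>, which reduces them to the radial integrals above.
\<close>

lemma integrable_gaussian_power:
  "integrable lborel (\<lambda>z::complex. cmod z ^ m * exp (- (cmod z)\<^sup>2))"
proof (rule Bochner_Integration.integrable_bound)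
  show "integrable lborel (\<lambda>z::complex. ((cmod z)\<^sup>2) ^ 0 * exp (- (cmod z)\<^sup>2) + ((cmod z)\<^sup>2) ^ m * exp (- (cmod z)\<^sup>2))"
    by (intro Bochner_Integration.integrable_add integrable.intros[OF has_bochner_integral_radial_gaussian])
  have "x ^ m \<le> 1 + (x\<^sup>2) ^ m" if "x \<ge> 0" for x :: real
  proof (cases "x \<le> 1")
    case True
    then have "x ^ m \<le> 1"
      using that by (simp add: power_le_one)
    then show ?thesis
      by (simp add: add_increasing2)
  next
    case False
    then have "x ^ m \<le> x ^ (2 * m)"
      by (intro power_increasing) auto
    then show ?thesis
      by (simp add: power_mult)
  qed
  then have "cmod z ^ m * exp (- (cmod z)\<^sup>2) \<le> (1 + ((cmod z)\<^sup>2) ^ m) * exp (- (cmod z)\<^sup>2)" for z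
    by (intro mult_right_mono) auto
  then show "AE z::complex in lborel. norm (cmod z ^ m * exp (- (cmod z)\<^sup>2))
      \<le> norm (((cmod z)\<^sup>2) ^ 0 * exp (- (cmod z)\<^sup>2) + ((cmod z)\<^sup>2) ^ m * exp (- (cmod z)\<^sup>2))"
    by (simp add: distrib_right)
qed measurable

text \<open>
  Monomials are orthogonal for the Gaussian weight. Off the diagonal, a rotation by the angle
  \<open>\<pi> / (i - j)\<close> preserves the measure and the weight but changes the sign of \<open>z\<^sup>i * cnj z\<^sup>j\<close>, so the
  integral equals its own negative. On the diagonal the integrand is radial.
\<close>

lemma has_bochner_integral_gaussian_moment:
  "has_bochner_integral lborel
     (\<lambda>z::complex. z ^ i * cnj z ^ j * of_real (exp (- (cmod z)\<^sup>2))) (if i = j then of_real (pi * fact i) else 0)"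
proof (cases "i = j")
  case True
  have "has_bochner_integral lborel
      (\<lambda>z::complex. complex_of_real (((cmod z)\<^sup>2) ^ i * exp (- (cmod z)\<^sup>2))) (of_real (pi * fact i))"
    by (intro has_bochner_integral_of_real has_bochner_integral_radial_gaussian)
  moreover have "complex_of_real (((cmod z)\<^sup>2) ^ i * t) = z ^ i * cnj z ^ i * of_real t" for z t
    by (simp only: of_real_mult of_real_power[of "(cmod z)\<^sup>2" i] complex_norm_square power_mult_distrib)
  ultimately show ?thesis
    using True by (simp only: if_True refl)
next
  case False
  let ?f = "\<lambda>z::complex. z ^ i * cnj z ^ j * of_real (exp (- (cmod z)\<^sup>2))"
  have [measurable]: "?f \<in> borel_measurable borel"
    by (intro borel_measurable_continuous_onI continuous_intros)
  have int: "integrable lborel ?f"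
    by (rule Bochner_Integration.integrable_bound[OF integrable_gaussian_power[of "i + j"]])
      (auto simp: norm_mult norm_power power_add simp del: of_real_exp)
  define w where "w = cis (pi / (real i - real j))"
  have w: "cmod w = 1"
    by (simp add: w_def)
  have "w ^ i * cnj w ^ j = cis (real i * (pi / (real i - real j)) - real j * (pi / (real i - real j)))"
    by (simp add: w_def cis_cnj Complex.DeMoivre cis_mult)
  also have "real i * (pi / (real i - real j)) - real j * (pi / (real i - real j)) = pi"
    unfolding left_diff_distrib[symmetric] using False by simp
  finally have w_power: "w ^ i * cnj w ^ j = - 1"
    by simp
  have "integral\<^sup>L lborel ?f = integral\<^sup>L (distr lborel borel ((*) w)) ?f"
    by (simp add: lborel_distr_orthogonal[OF orthogonal_transformation_unimodular[OF w]])
  also have "\<dots> = integral\<^sup>L lborel (\<lambda>z. ?f (w * z))"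
    by (rule integral_distr) measurable
  also have "(\<lambda>z. ?f (w * z)) = (\<lambda>z. (w ^ i * cnj w ^ j) * ?f z)"
    by (simp add: fun_eq_iff power_mult_distrib norm_mult w mult_ac)
  also have "integral\<^sup>L lborel \<dots> = - integral\<^sup>L lborel ?f"
    unfolding w_power by simp
  finally have "integral\<^sup>L lborel ?f = 0"
    by simp
  then show ?thesis
    using int False by (simp add: has_bochner_integral_iff)
qed

text \<open>
  Writing \<open>|W|\<^sup>2 = W * cnj W\<close> turns the integral into the Gaussian pairing of \<open>P W\<close> with
  \<open>z\<^sup>k W\<close>, which the orthogonality of monomials evaluates as a Fischer moment.
\<close>

lemma planar_moment:
  "(LINT z|planar_measure W. poly P z * cnj z ^ k) = fischer_moment (conj_poly W) (P * W) k"
proof -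
  let ?q = "conj_poly W" and ?f = "P * W"
  have "(LINT z|planar_measure W. poly P z * cnj z ^ k)
      = (LINT z|lborel. (1 / pi * (cmod (poly W z))\<^sup>2 * exp (- (cmod z)\<^sup>2)) *\<^sub>R (poly P z * cnj z ^ k))"
    unfolding planar_measure_def
    by (rule integral_density) (auto intro!: borel_measurable_continuous_onI continuous_intros)
  also have "\<dots> = (LINT z|lborel. (\<Sum>m\<le>degree ?q. \<Sum>i\<le>degree ?f. coeff ?q m * coeff ?f i / of_real pi *
      (z ^ i * cnj z ^ (m + k) * of_real (exp (- (cmod z)\<^sup>2)))))"
  proof (intro Bochner_Integration.integral_cong refl)
    fix z :: complex
    have "(1 / pi * (cmod (poly W z))\<^sup>2 * exp (- (cmod z)\<^sup>2)) *\<^sub>R (poly P z * cnj z ^ k)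
        = poly ?q (cnj z) * poly ?f z * (cnj z ^ k * of_real (exp (- (cmod z)\<^sup>2)) / of_real pi)"
      by (simp add: scaleR_conv_of_real complex_norm_square poly_conj_poly mult_ac del: of_real_exp of_real_power)
    also have "\<dots> = (\<Sum>m\<le>degree ?q. \<Sum>i\<le>degree ?f. coeff ?q m * coeff ?f i / of_real pi *
        (z ^ i * cnj z ^ (m + k) * of_real (exp (- (cmod z)\<^sup>2))))"
      unfolding poly_altdef sum_product unfolding sum_distrib_right
      by (intro sum.cong refl) (simp add: power_add mult_ac)
    finally show "(1 / pi * (cmod (poly W z))\<^sup>2 * exp (- (cmod z)\<^sup>2)) *\<^sub>R (poly P z * cnj z ^ k) = \<dots>" .
  qed
  also have "\<dots> = (\<Sum>m\<le>degree ?q. \<Sum>i\<le>degree ?f. coeff ?q m * coeff ?f i / of_real pi *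
      (if i = m + k then of_real (pi * fact i) else 0))"
    by (intro has_bochner_integral_integral_eq has_bochner_integral_sum has_bochner_integral_mult_right
        has_bochner_integral_gaussian_moment)
  also have "\<dots> = (\<Sum>m\<le>degree ?q. \<Sum>i\<le>degree ?f. coeff ?q m * coeff ?f i *
      (if i = m + k then fact (m + k) else 0))"
    by (intro sum.cong refl) auto
  also have "\<dots> = fischer_moment ?q ?f k"
    by (rule double_sum_fischer_moment)
  finally show ?thesis .
qed

section \<open>Laplace transforms along rays and contour integrals\<close>

text \<open>
  On the ray through \<open>cnj z\<close> the product \<open>u z\<close> is real and positive, so this is the factorial integral
  \<open>\<integral> r\<^sup>j e\<^bsup>-|z|r\<^esup> dr = j! / |z|\<^sup>j\<^sup>+\<^sup>1\<close> times \<open>j + 1\<close> factors \<open>sgn (cnj z)\<close>, which change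
  \<open>|z|\<close> into \<open>z\<close>.
\<close>

lemma has_bochner_integral_ray_power_exp:
  assumes "z \<noteq> 0"
  shows "has_bochner_integral lborel
    (\<lambda>r. indicator {0..} r *\<^sub>R ((of_real r * sgn (cnj z)) ^ j * exp (- (of_real r * sgn (cnj z)) * z) * sgn (cnj z)))
    (fact j / z ^ Suc j)"
proof -
  define l where "l = cmod z"
  have l: "l > 0"
    using assms by (simp add: l_def)
  have sgn: "sgn (cnj z) * z = of_real l" "sgn (cnj z) / of_real l = 1 / z"
    using assms complex_norm_square[of z]
    by (auto simp: l_def sgn_div_norm scaleR_conv_of_real field_simps power2_eq_square)
  have "has_bochner_integral lborel
      (\<lambda>r. of_real (indicator {0..} r * (r ^ j * exp (- l * r))) * sgn (cnj z) ^ Suc j)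
      (of_real (fact j / l ^ Suc j) * sgn (cnj z) ^ Suc j)"
    by (intro has_bochner_integral_mult_left has_bochner_integral_of_real has_bochner_integral_power_exp l)
  moreover have "of_real (fact j / l ^ Suc j) * sgn (cnj z) ^ Suc j = fact j / z ^ Suc j"
  proof -
    have "of_real (fact j / l ^ Suc j) * sgn (cnj z) ^ Suc j = fact j * (sgn (cnj z) / of_real l) ^ Suc j"
      by (simp add: power_divide)
    then show ?thesis
      by (simp add: sgn(2) power_divide)
  qed
  moreover have "of_real (indicator {0..} r * (r ^ j * exp (- l * r))) * sgn (cnj z) ^ Suc j
      = indicator {0..} r *\<^sub>R ((of_real r * sgn (cnj z)) ^ j * exp (- (of_real r * sgn (cnj z)) * z) * sgn (cnj z))" for r
  proof -
    have "- (of_real r * sgn (cnj z)) * z = of_real (- l * r)"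
      using sgn(1) by (simp add: mult.assoc mult.commute)
    then have "exp (- (of_real r * sgn (cnj z)) * z) = of_real (exp (- l * r))"
      by (simp only: exp_of_real)
    then show ?thesis
      by (simp add: scaleR_conv_of_real power_mult_distrib mult_ac del: of_real_exp)
  qed
  ultimately show ?thesis
    by simp
qed

text \<open>
  Although the path of integration depends on \<open>z\<close> through its conjugate, the result is a Laurent
  polynomial in \<open>z\<close>.
\<close>

lemma phi_eq:
  assumes "z \<noteq> 0"
  shows "phi W k z = (\<Sum>m\<le>degree (conj_poly W). coeff (conj_poly W) m * fact (m + k) / z ^ Suc (m + k))"
proof -
  let ?q = "conj_poly W" and ?u = "\<lambda>r. of_real r * sgn (cnj z)"
  have "has_bochner_integral lborel
      (\<lambda>r. \<Sum>m\<le>degree ?q. coeff ?q m *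
        (indicator {0..} r *\<^sub>R (?u r ^ (m + k) * exp (- ?u r * z) * sgn (cnj z))))
      (\<Sum>m\<le>degree ?q. coeff ?q m * (fact (m + k) / z ^ Suc (m + k)))"
    by (intro has_bochner_integral_sum has_bochner_integral_mult_right has_bochner_integral_ray_power_exp assms)
  moreover have "(\<Sum>m\<le>degree ?q. coeff ?q m *
        (indicator {0..} r *\<^sub>R (?u r ^ (m + k) * exp (- ?u r * z) * sgn (cnj z))))
      = indicator {0..} r *\<^sub>R (poly ?q (?u r) * ?u r ^ k * exp (- ?u r * z) * sgn (cnj z))" for r
    by (cases "r \<ge> 0")
      (simp_all add: poly_altdef sum_distrib_left sum_distrib_right power_add mult_ac)
  ultimately have "has_bochner_integral lborel
      (\<lambda>r. indicator {0..} r *\<^sub>R (poly ?q (?u r) * ?u r ^ k * exp (- ?u r * z) * sgn (cnj z)))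
      (\<Sum>m\<le>degree ?q. coeff ?q m * (fact (m + k) / z ^ Suc (m + k)))"
    by (simp only:)
  from has_bochner_integral_integral_eq[OF this] show ?thesis
    by (simp only: phi_def ray_integral_def set_lebesgue_integral_def times_divide_eq_right)
qed

text \<open>
  Every integer power except \<open>z\<^sup>-\<^sup>1\<close> has a single-valued primitive off the origin.
\<close>

lemma has_contour_integral_power_int:
  assumes "valid_path \<gamma>" "pathfinish \<gamma> = pathstart \<gamma>" "0 \<notin> path_image \<gamma>"
  shows "((\<lambda>z. z powi n) has_contour_integral
    (if n = - 1 then 2 * of_real pi * \<i> * winding_number \<gamma> 0 else 0)) \<gamma>"
proof (cases "n = - 1")
  case True
  have "((\<lambda>w. 1 / (w - 0)) has_contour_integral 2 * of_real pi * \<i> * winding_number \<gamma> 0) \<gamma>"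
    using has_contour_integral_winding_number[OF assms(1,3)] by simp
  then show ?thesis
    using True by (simp add: field_simps)
next
  case False
  then have nz: "of_int (n + 1) \<noteq> (0 :: complex)"
    by (metis add.commute add_eq_0_iff of_int_eq_0_iff)
  have "((\<lambda>z. z powi n) has_contour_integral 0) \<gamma>"
  proof (rule Cauchy_theorem_primitive[where S = "- {0}"])
    fix z :: complex assume "z \<in> - {0}"
    then have "((\<lambda>z. z powi (n + 1) / of_int (n + 1)) has_field_derivative
        of_int (n + 1) * z powi (n + 1 - 1) * 1 / of_int (n + 1)) (at z within - {0})"
      by (intro DERIV_cdivide DERIV_power_int DERIV_ident) auto
    then show "((\<lambda>z. z powi (n + 1) / of_int (n + 1)) has_field_derivative z powi n) (at z within - {0})"
      using nz by simp
  qed (use assms in auto)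
  then show ?thesis
    using False by simp
qed

text \<open>
  By the residue computation above, integrating against \<open>m! / z\<^bsup>m+1\<^esup>\<close> extracts \<open>m!\<close> times the coefficient
  of \<open>z\<^sup>m\<close>, up to the factor \<open>2 \<pi> \<i>\<close>.
\<close>

lemma contour_moment:
  assumes "contour_around_origin \<gamma>"
  shows "1 / (2 * of_real pi * \<i>) * contour_integral \<gamma> (\<lambda>z. poly f z * phi W k z)
    = fischer_moment (conj_poly W) f k"
proof -
  let ?q = "conj_poly W"
  have \<gamma>: "valid_path \<gamma>" "pathfinish \<gamma> = pathstart \<gamma>" "0 \<notin> path_image \<gamma>" "winding_number \<gamma> 0 = 1"
    using assms by (auto simp: contour_around_origin_def)
  have "((\<lambda>z. \<Sum>m\<le>degree ?q. \<Sum>i\<le>degree f. coeff ?q m * coeff f i * fact (m + k) *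
        z powi (int i - int (m + k) - 1)) has_contour_integral
      (\<Sum>m\<le>degree ?q. \<Sum>i\<le>degree f. coeff ?q m * coeff f i * fact (m + k) *
        (if int i - int (m + k) - 1 = - 1 then 2 * of_real pi * \<i> * winding_number \<gamma> 0 else 0))) \<gamma>"
    by (intro has_contour_integral_sum has_contour_integral_lmul has_contour_integral_power_int \<gamma>) auto
  moreover have "(\<Sum>m\<le>degree ?q. \<Sum>i\<le>degree f. coeff ?q m * coeff f i * fact (m + k) *
        z powi (int i - int (m + k) - 1)) = poly f z * phi W k z" if "z \<in> path_image \<gamma>" for z
  proof -
    have "z \<noteq> 0"
      using that \<gamma>(3) by auto
    then have "z powi (int i - int (m + k) - 1) = z ^ i / z ^ Suc (m + k)" for i m
      by (simp add: power_int_diff power_int_minus power_add flip: diff_diff_eq)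
    then show ?thesis
      unfolding phi_eq[OF \<open>z \<noteq> 0\<close>] poly_altdef sum_product
      by (subst sum.swap) (simp add: power_add mult_ac)
  qed
  ultimately have "contour_integral \<gamma> (\<lambda>z. poly f z * phi W k z)
      = (\<Sum>m\<le>degree ?q. \<Sum>i\<le>degree f. coeff ?q m * coeff f i * fact (m + k) *
        (if int i - int (m + k) - 1 = - 1 then 2 * of_real pi * \<i> * winding_number \<gamma> 0 else 0))"
    by (intro contour_integral_unique) (rule has_contour_integral_eq)
  also have "\<dots> = 2 * of_real pi * \<i> * (\<Sum>m\<le>degree ?q. \<Sum>i\<le>degree f. coeff ?q m * coeff f i *
      (if i = m + k then fact (m + k) else 0))"
    unfolding sum_distrib_left by (intro sum.cong refl) (auto simp: \<gamma>(4))
  finally show ?thesis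
    by (simp add: double_sum_fischer_moment)
qed

section \<open>Constant-coefficient operators on formal power series\<close>

text \<open>
  The formal counterpart of \<^const>\<open>poly_diffop\<close>. Conditions of the form \<open>O(z\<^sup>N)\<close> on analytic functions
  speak about finitely many Taylor coefficients only, so the differential equation behind them can be
  solved coefficientwise, with no question of convergence.
\<close>

definition fps_diffop :: "'a::field_char_0 poly \<Rightarrow> 'a fps \<Rightarrow> 'a fps" where
  "fps_diffop q F = (\<Sum>i\<le>degree q. fps_const (coeff q i) * (fps_deriv ^^ i) F)"

lemma fps_diffop_altdef:
  assumes "degree q \<le> N"
  shows "fps_diffop q F = (\<Sum>i\<le>N. fps_const (coeff q i) * (fps_deriv ^^ i) F)"
  unfolding fps_diffop_def
  by (rule sum.mono_neutral_left) (use assms in \<open>auto simp: coeff_eq_0\<close>)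

lemma fps_higher_deriv_diff_cmult:
  fixes F G :: "'a::field_char_0 fps"
  shows "(fps_deriv ^^ i) (F - fps_const b * G) = (fps_deriv ^^ i) F - fps_const b * (fps_deriv ^^ i) G"
  by (induction i) simp_all

text \<open>
  Multiplying the symbol by a linear factor composes the operator with a first-order one. The factor
  is split off next to \<open>F\<close>, the side on which the induction for \<open>fps_diffop_vanishes_iff\<close> peels.
\<close>

lemma fps_diffop_linear_factor:
  "fps_diffop ([:- b, 1:] * q) F = fps_diffop q (fps_deriv F - fps_const b * F)"
proof -
  define N where "N = degree q"
  have eq: "[:- b, 1:] * q = pCons 0 q - smult b q"
    by simp
  have deg: "degree ([:- b, 1:] * q) \<le> Suc N"
    using degree_mult_le[of "[:- b, 1:]" q] by (simp add: N_def)
  have "fps_diffop ([:- b, 1:] * q) F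
      = (\<Sum>i\<le>Suc N. fps_const (coeff (pCons 0 q) i) * (fps_deriv ^^ i) F)
        - fps_const b * (\<Sum>i\<le>Suc N. fps_const (coeff q i) * (fps_deriv ^^ i) F)"
    unfolding fps_diffop_altdef[OF deg] unfolding eq
    by (simp only: coeff_diff coeff_smult left_diff_distrib sum_subtractf sum_distrib_left mult.assoc
        flip: fps_const_sub fps_const_mult)
  also have "(\<Sum>i\<le>Suc N. fps_const (coeff (pCons 0 q) i) * (fps_deriv ^^ i) F)
      = fps_diffop q (fps_deriv F)"
    by (subst sum.atMost_Suc_shift)
      (simp add: fps_diffop_def N_def funpow_Suc_right del: funpow.simps)
  also have "(\<Sum>i\<le>Suc N. fps_const (coeff q i) * (fps_deriv ^^ i) F) = fps_diffop q F"
    by (rule fps_diffop_altdef[symmetric]) (simp add: N_def)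
  also have "fps_diffop q (fps_deriv F) - fps_const b * fps_diffop q F
      = fps_diffop q (fps_deriv F - fps_const b * F)"
    unfolding fps_diffop_def fps_higher_deriv_diff_cmult right_diff_distrib sum_subtractf sum_distrib_left
    by (simp only: mult.left_commute)
  finally show ?thesis .
qed

lemma fps_higher_deriv_nth:
  fixes F :: "'a::field_char_0 fps"
  shows "fact k * (fps_deriv ^^ m) F $ k = fact (m + k) * F $ (m + k)"
proof -
  have "(fps_deriv ^^ (k + m)) F $ 0 = fact k * (fps_deriv ^^ m) F $ k"
    by (simp add: funpow_add fps_0th_higher_deriv)
  then show ?thesis
    by (simp add: fps_0th_higher_deriv add.commute)
qed

text \<open>
  The \<open>k\<close>-th Taylor coefficient of \<open>q(d/dz) f\<close> is the \<open>k\<close>-th Fischer moment up to \<open>k!\<close>: differentiation is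
  adjoint to multiplication by the variable in the Fischer inner product.
\<close>

lemma fps_diffop_nth_fps_of_poly:
  "fact k * fps_diffop q (fps_of_poly f) $ k = fischer_moment q f k"
proof -
  have "fact k * fps_diffop q (fps_of_poly f) $ k
      = (\<Sum>m\<le>degree q. coeff q m * (fact k * (fps_deriv ^^ m) (fps_of_poly f) $ k))"
    by (simp add: fps_diffop_def fps_sum_nth sum_distrib_left mult.left_commute)
  then show ?thesis
    by (simp add: fischer_moment_def fps_higher_deriv_nth mult.assoc)
qed

text \<open>
  A formal version of uniqueness for first-order initial value problems: the equation determines
  each coefficient from the previous one, so the right-hand side vanishing to order \<open>N\<close> and a zero
  initial value make \<open>F\<close> vanish to order \<open>N + 1\<close>.
\<close>

lemma fps_vanishes_Suc_iff:
  fixes F :: "'a::field_char_0 fps"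
  shows "(\<forall>k<Suc N. F $ k = 0) \<longleftrightarrow>
    F $ 0 = 0 \<and> (\<forall>k<N. (fps_deriv F - fps_const b * F) $ k = 0)"
proof (intro iffI conjI allI impI; (elim conjE)?)
  fix k assume 0: "F $ 0 = 0" "\<forall>k<N. (fps_deriv F - fps_const b * F) $ k = 0" and "k < Suc N"
  from \<open>k < Suc N\<close> show "F $ k = 0"
  proof (induction k)
    case (Suc k)
    have "of_nat (Suc k) * F $ Suc k = (0::'a)"
      using 0(2)[rule_format, of k] Suc by simp
    then show ?case
      by (simp del: of_nat_Suc)
  qed (use 0 in simp)
qed auto

text \<open>
  In the next two lemmas \<open>(d/dz - b) (R e\<^bsup>(b+d)z\<^esup>) = (R' + d R) e\<^bsup>(b+d)z\<^esup>\<close> is solved for the polynomial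
  \<open>R\<close>. The degree bound goes up by one in the resonant case \<open>d = 0\<close> and is unchanged otherwise. Degree
  bounds are stated through coefficients, because the zero polynomial must be the only one allowed
  by the bound \<open>m = 0\<close>.
\<close>

lemma poly_antiderivative:
  fixes Q :: "'a::field_char_0 poly"
  assumes "\<forall>k\<ge>m. coeff Q k = 0"
  shows "\<exists>R. pderiv R = Q \<and> (\<forall>k\<ge>Suc m. coeff R k = 0)"
proof (intro exI conjI)
  let ?R = "\<Sum>k<m. monom (coeff Q k / of_nat (Suc k)) (Suc k)"
  have "pderiv ?R = (\<Sum>k<m. monom (coeff Q k) k)"
    by (simp add: higher_pderiv_sum[of 1, simplified] pderiv_monom del: of_nat_Suc)
  also have "\<dots> = Q"
    using assms by (intro poly_eqI) (auto simp: coeff_sum not_less)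
  finally show "pderiv ?R = Q" .
qed (auto simp: coeff_sum)

text \<open>
  The recursion is the Neumann series of \<open>(d + D)\<^sup>-\<^sup>1\<close>, which is finite since the derivation \<open>D\<close> is nilpotent on
  polynomials of bounded degree.
\<close>

lemma poly_resolvent:
  fixes Q :: "'a::field_char_0 poly"
  assumes "d \<noteq> 0" "\<forall>k\<ge>m. coeff Q k = 0"
  shows "\<exists>R. pderiv R + smult d R = Q \<and> (\<forall>k\<ge>m. coeff R k = 0)"
  using assms(2)
proof (induction m arbitrary: Q)
  case 0
  then have "Q = 0"
    by (simp add: poly_eq_iff)
  then show ?case
    by (intro exI[of _ 0]) auto
next
  case (Suc m)
  have "\<forall>k\<ge>m. coeff (pderiv Q) k = 0"
    using Suc.prems by (simp add: coeff_pderiv)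
  from Suc.IH[OF this] obtain R where R: "pderiv R + smult d R = pderiv Q" "\<forall>k\<ge>m. coeff R k = 0"
    by blast
  define S where "S = smult (1 / d) (Q - R)"
  have "pderiv S = smult (1 / d) (pderiv Q - pderiv R)"
    by (simp add: S_def pderiv_smult pderiv_diff)
  also have "\<dots> = R"
    using assms(1) by (simp flip: R(1))
  finally have "pderiv S + smult d S = Q"
    using assms(1) by (simp add: S_def)
  moreover have "\<forall>k\<ge>Suc m. coeff S k = 0"
    using R(2) Suc.prems by (simp add: S_def)
  ultimately show ?case
    by blast
qed

definition exp_poly_fps :: "'i set \<Rightarrow> ('i \<Rightarrow> 'a::field_char_0) \<Rightarrow> ('i \<Rightarrow> 'a poly) \<Rightarrow> 'a fps" where
  "exp_poly_fps J b Q = (\<Sum>j\<in>J. fps_of_poly (Q j) * fps_exp (b j))"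

lemma fps_deriv_exp_poly_fps:
  "fps_deriv (exp_poly_fps J b Q) - fps_const d * exp_poly_fps J b Q
    = exp_poly_fps J b (\<lambda>j. pderiv (Q j) + smult (b j - d) (Q j))"
  by (simp add: exp_poly_fps_def fps_deriv_sum sum_distrib_left fps_of_poly_add fps_of_poly_smult
      fps_of_poly_pderiv algebra_simps flip: sum_subtractf fps_const_sub)

text \<open>
  This carries the passage between the differential condition and the approximation by exponential
  polynomials. The induction removes one linear factor \<open>D = d/dz - b\<^sub>i\<close> at a time. By the hypothesis
  applied to \<open>D F\<close>, some exponential polynomial corrects \<open>D F\<close> to high order, and distinct
  exponents let it be written as \<open>D\<close> of an exponential polynomial \<open>E\<close>, with the degree at \<open>b\<^sub>i\<close> raised by
  one. Subtracting from \<open>E\<close> a multiple of \<open>e\<^bsup>b\<^sub>i z\<^esup>\<close>, which \<open>D\<close> does not see, makes the constant term of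
  \<open>F + E\<close> vanish, and one more order is gained. The converse applies \<open>D\<close> and keeps track of the degrees.
\<close>

lemma fps_diffop_vanishes_iff:
  fixes b :: "'i \<Rightarrow> 'a::field_char_0"
  assumes "finite J" and "inj_on b J"
  shows "(\<forall>k<n. fps_diffop (\<Prod>j\<in>J. [:- b j, 1:] ^ c j) F $ k = 0) \<longleftrightarrow>
    (\<exists>Q. (\<forall>j\<in>J. \<forall>k\<ge>c j. coeff (Q j) k = 0) \<and>
         (\<forall>k<n + sum c J. (F + exp_poly_fps J b Q) $ k = 0))"
proof (induction "sum c J" arbitrary: c F)
  case 0
  then have c0: "c j = 0" if "j \<in> J" for j
    using assms(1) that by simp
  have "(\<Prod>j\<in>J. [:- b j, 1:] ^ c j) = 1"
    using c0 by (intro prod.neutral) auto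
  moreover have "exp_poly_fps J b Q = 0" if "\<forall>j\<in>J. \<forall>k\<ge>c j. coeff (Q j) k = 0" for Q
  proof -
    have "Q j = 0" if "j \<in> J" for j
      using \<open>\<forall>j\<in>J. \<forall>k\<ge>c j. coeff (Q j) k = 0\<close> c0 that by (simp add: poly_eq_iff)
    then show ?thesis
      by (simp add: exp_poly_fps_def)
  qed
  ultimately show ?case
    using 0 by (auto simp: fps_diffop_def intro: exI[of _ "\<lambda>_. 0"])
next
  case (Suc m)
  then obtain i where i: "i \<in> J" "c i > 0"
    by (metis gr0I sum.neutral nat.distinct(1))
  define c' where "c' = c(i := c i - 1)"
  define D where "D = (\<lambda>F. fps_deriv F - fps_const (b i) * F)"
  have c: "c = c'(i := Suc (c' i))"
    using i by (simp add: c'_def)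
  have sum_c: "sum c J = Suc (sum c' J)"
    using assms(1) i by (simp add: c'_def sum.remove[of J i])
  have prod_c: "(\<Prod>j\<in>J. [:- b j, 1:] ^ c j) = [:- b i, 1:] * (\<Prod>j\<in>J. [:- b j, 1:] ^ c' j)"
  proof -
    have "(\<Prod>j\<in>J - {i}. [:- b j, 1:] ^ c j) = (\<Prod>j\<in>J - {i}. [:- b j, 1:] ^ c' j)"
      by (intro prod.cong) (auto simp: c'_def)
    moreover have "[:- b i, 1:] ^ c i = [:- b i, 1:] * [:- b i, 1:] ^ c' i"
      by (subst c) simp
    ultimately show ?thesis
      using assms(1) i by (simp only: prod.remove[of J i] mult.assoc)
  qed
  have van_iff: "(\<forall>k<Suc N. G $ k = 0) \<longleftrightarrow> G $ 0 = 0 \<and> (\<forall>k<N. D G $ k = 0)" for N G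
    unfolding D_def by (rule fps_vanishes_Suc_iff)
  have D_add: "D (F + exp_poly_fps J b Q)
      = D F + exp_poly_fps J b (\<lambda>j. pderiv (Q j) + smult (b j - b i) (Q j))" for Q
    unfolding fps_deriv_exp_poly_fps[of J b Q "b i", symmetric] by (simp add: D_def algebra_simps)
  have "(\<forall>k<n. fps_diffop (\<Prod>j\<in>J. [:- b j, 1:] ^ c j) F $ k = 0) \<longleftrightarrow>
      (\<exists>Q. (\<forall>j\<in>J. \<forall>k\<ge>c' j. coeff (Q j) k = 0) \<and>
           (\<forall>k<n + sum c' J. (D F + exp_poly_fps J b Q) $ k = 0))"
    unfolding prod_c fps_diffop_linear_factor D_def
    using Suc.hyps(1)[of c'] Suc.hyps(2) sum_c by simp
  also have "\<dots> \<longleftrightarrow> (\<exists>Q. (\<forall>j\<in>J. \<forall>k\<ge>c j. coeff (Q j) k = 0) \<and>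
      (\<forall>k<Suc (n + sum c' J). (F + exp_poly_fps J b Q) $ k = 0))"
  proof (intro iffI; elim exE conjE)
    fix Q assume Q: "\<forall>j\<in>J. \<forall>k\<ge>c j. coeff (Q j) k = 0"
      and van: "\<forall>k<Suc (n + sum c' J). (F + exp_poly_fps J b Q) $ k = 0"
    let ?Q' = "\<lambda>j. pderiv (Q j) + smult (b j - b i) (Q j)"
    have "coeff (?Q' j) k = 0" if "j \<in> J" "k \<ge> c' j" for j k
    proof -
      have "coeff (Q j) (Suc k) = 0"
        using Q that by (auto simp: c'_def split: if_splits)
      moreover have "j \<noteq> i \<Longrightarrow> coeff (Q j) k = 0"
        using Q that by (auto simp: c'_def)
      ultimately show ?thesis
        by (auto simp: coeff_pderiv)
    qed
    moreover have "\<forall>k<n + sum c' J. (D F + exp_poly_fps J b ?Q') $ k = 0"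
      unfolding D_add[symmetric] using van van_iff by blast
    ultimately show "\<exists>Q. (\<forall>j\<in>J. \<forall>k\<ge>c' j. coeff (Q j) k = 0) \<and>
        (\<forall>k<n + sum c' J. (D F + exp_poly_fps J b Q) $ k = 0)"
      by (intro exI[of _ ?Q'] conjI ballI allI impI) simp_all
  next
    fix Q' assume Q': "\<forall>j\<in>J. \<forall>k\<ge>c' j. coeff (Q' j) k = 0"
      and van: "\<forall>k<n + sum c' J. (D F + exp_poly_fps J b Q') $ k = 0"
    have "\<exists>R. pderiv R + smult (b j - b i) R = Q' j \<and> (\<forall>k\<ge>c j. coeff R k = 0)" if "j \<in> J" for j
    proof (cases "j = i")
      case True
      then show ?thesis
        using poly_antiderivative[of "c' i" "Q' i"] Q' i by (simp add: c'_def)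
    next
      case False
      then have "b j - b i \<noteq> 0"
        using assms(2) i that by (auto simp: inj_on_def)
      then show ?thesis
        using poly_resolvent[of "b j - b i" "c' j" "Q' j"] Q' that False by (simp add: c'_def)
    qed
    then obtain R where R: "\<And>j. j \<in> J \<Longrightarrow> pderiv (R j) + smult (b j - b i) (R j) = Q' j"
        "\<And>j k. j \<in> J \<Longrightarrow> k \<ge> c j \<Longrightarrow> coeff (R j) k = 0"
      by metis
    \<comment> \<open>\<open>t\<close> is the defect in the initial value; it is removed by the homogeneous solution \<open>t e\<^bsup>b\<^sub>i z\<^esup>\<close>.\<close>
    define t where "t = (F + exp_poly_fps J b R) $ 0"
    define Q where "Q = R(i := R i - [:t:])"
    have "exp_poly_fps J b Q = exp_poly_fps J b R - fps_const t * fps_exp (b i)"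
    proof -
      have "(\<Sum>j\<in>J - {i}. fps_of_poly (Q j) * fps_exp (b j))
          = (\<Sum>j\<in>J - {i}. fps_of_poly (R j) * fps_exp (b j))"
        by (intro sum.cong) (auto simp: Q_def)
      then show ?thesis
        using assms(1) i
        by (simp add: exp_poly_fps_def sum.remove[of J i] Q_def fps_of_poly_diff algebra_simps)
    qed
    then have Q0: "(F + exp_poly_fps J b Q) $ 0 = 0"
      by (simp add: t_def)
    have "exp_poly_fps J b (\<lambda>j. pderiv (Q j) + smult (b j - b i) (Q j)) = exp_poly_fps J b Q'"
      unfolding exp_poly_fps_def using R(1)
      by (intro sum.cong) (auto simp: Q_def pderiv_diff pderiv_pCons simp flip: R(1))
    then have "\<forall>k<Suc (n + sum c' J). (F + exp_poly_fps J b Q) $ k = 0"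
      using van Q0 by (simp only: van_iff D_add)
    moreover have "\<forall>j\<in>J. \<forall>k\<ge>c j. coeff (Q j) k = 0"
      using R(2) i by (auto simp: Q_def coeff_pCons split: nat.splits)
    ultimately show "\<exists>Q. (\<forall>j\<in>J. \<forall>k\<ge>c j. coeff (Q j) k = 0) \<and>
        (\<forall>k<Suc (n + sum c' J). (F + exp_poly_fps J b Q) $ k = 0)"
      by (intro exI[of _ Q] conjI)
  qed
  finally show ?case
    by (simp add: sum_c)
qed

section \<open>Taylor coefficients and orders of vanishing\<close>

text \<open>
  A nonzero analytic function is asymptotic to its leading Taylor term \<open>F $ s * z ^ s\<close>, and
  \<open>z ^ s\<close> is \<open>O(z ^ N)\<close> at the origin exactly for \<open>N \<le> s\<close>.
\<close>

lemma has_fps_expansion_bigo_iff: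
  fixes f :: "complex \<Rightarrow> complex"
  assumes "f has_fps_expansion F"
  shows "f \<in> O[at 0](\<lambda>z. z ^ N) \<longleftrightarrow> (\<forall>k<N. F $ k = 0)"
proof (cases "F = 0")
  case True
  then have "eventually (\<lambda>z. f z = 0) (at 0)"
    using assms by (simp add: has_fps_expansion_0_iff eventually_nhds_conv_at)
  then have "f \<in> O[at 0](\<lambda>z. z ^ N) \<longleftrightarrow> (\<lambda>_. 0) \<in> O[at 0](\<lambda>z::complex. z ^ N)"
    by (rule landau_o.big.in_cong)
  then show ?thesis
    using True by simp
next
  case False
  define s where "s = subdegree F"
  have Fs: "F $ s \<noteq> 0"
    using False by (simp add: s_def)
  have "f \<sim>[at 0] (\<lambda>z. F $ s * z ^ s)"
    unfolding s_def using has_fps_expansion_imp_asymp_equiv_0[OF assms]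
    by (simp add: asymp_equiv_nhds_iff)
  then have "f \<in> O[at 0](\<lambda>z. z ^ N) \<longleftrightarrow> (\<lambda>z. F $ s * z ^ s) \<in> O[at 0](\<lambda>z. z ^ N)"
    by (meson asymp_equiv_imp_bigtheta landau_o.big.in_cong_bigtheta)
  also have "\<dots> \<longleftrightarrow> (\<lambda>z::complex. z ^ s) \<in> O[at 0](\<lambda>z. z ^ N)"
    using Fs by simp
  also have "\<dots> \<longleftrightarrow> N \<le> s"
  proof
    assume "N \<le> s"
    have "eventually (\<lambda>z::complex. z \<in> ball 0 1) (at 0)"
      by (rule eventually_at_in_open') auto
    then show "(\<lambda>z::complex. z ^ s) \<in> O[at 0](\<lambda>z. z ^ N)"
      using \<open>N \<le> s\<close>
      by (intro bigoI[of _ 1]) (auto elim!: eventually_mono simp: norm_power intro!: power_decreasing)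
  next
    assume bigo: "(\<lambda>z::complex. z ^ s) \<in> O[at 0](\<lambda>z. z ^ N)"
    show "N \<le> s"
    proof (rule ccontr)
      assume "\<not> N \<le> s"
      then obtain d where d: "N = s + d" "d > 0"
        by (metis less_imp_add_positive not_le)
      have ne: "eventually (\<lambda>z::complex. z ^ s \<noteq> 0) (at 0)"
        by (rule eventually_mono[OF eventually_neq_at_within[of 0 0 UNIV]]) simp
      have "(\<lambda>z::complex. z ^ s * 1) \<in> O[at 0](\<lambda>z. z ^ s * z ^ d)"
        using bigo d by (simp add: power_add)
      then have "(\<lambda>z::complex. 1 :: complex) \<in> O[at 0](\<lambda>z::complex. z ^ d)"
        by (subst (asm) landau_o.big.mult_cancel_left[OF bigtheta_refl])
          (rule ne)
      moreover have "(\<lambda>z::complex. z ^ d) \<in> o[at 0](\<lambda>z. 1 :: complex)"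
      proof (intro smalloI_tendsto)
        have "((\<lambda>z::complex. z ^ d) \<longlongrightarrow> 0) (at 0)"
          using d by (auto intro!: tendsto_eq_intros)
        then show "((\<lambda>z::complex. z ^ d / 1) \<longlongrightarrow> 0) (at 0)"
          by simp
      qed auto
      ultimately have "(\<lambda>z::complex. 1 :: complex) \<in> o[at 0](\<lambda>z. 1)"
        by (rule landau_o.big_small_trans)
      then show False
        by (simp add: landau_o.small_refl_iff)
    qed
  qed
  also have "\<dots> \<longleftrightarrow> (\<forall>k<N. F $ k = 0)"
    using Fs by (metis s_def nth_less_subdegree_zero not_le order_less_le_trans)
  finally show ?thesis .
qed

lemma poly_has_fps_expansion: "poly q has_fps_expansion fps_of_poly (q :: complex poly)"
proof (induction q)
  case (pCons a q)
  have "(\<lambda>z. a + z * poly q z) has_fps_expansion fps_const a + fps_X * fps_of_poly q"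
    by (intro fps_expansion_intros pCons)
  then show ?case
    by (simp add: fps_of_poly_pCons fun_eq_iff algebra_simps poly_pCons[abs_def])
qed (simp add: poly_0[abs_def])

lemma has_fps_expansion_higher_deriv:
  fixes f :: "complex \<Rightarrow> complex"
  assumes "f has_fps_expansion F"
  shows "(deriv ^^ i) f has_fps_expansion (fps_deriv ^^ i) F"
  by (induction i) (auto intro: assms has_fps_expansion_deriv)

lemma has_fps_expansion_poly_diffop:
  assumes "f has_fps_expansion F"
  shows "poly_diffop q f has_fps_expansion fps_diffop q F"
  unfolding poly_diffop_def[abs_def] fps_diffop_def
  by (intro has_fps_expansion_sum has_fps_expansion_mult has_fps_expansion_const
      has_fps_expansion_higher_deriv assms)

section \<open>The four characterizations\<close>

theorem theorem2p1:
  fixes p n :: nat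
    and a :: "nat \<Rightarrow> complex"
    and c :: "nat \<Rightarrow> nat"
    and W P :: "complex poly"
    and \<gamma> :: "real \<Rightarrow> complex"
  assumes a_distinct: "inj_on a {1..p}"
    and c_pos: "\<And>j. j \<in> {1..p} \<Longrightarrow> c j > 0"
    and W: "W = (\<Prod>j=1..p. [:- a j, 1:] ^ c j)"
    and P: "degree P = n" "lead_coeff P = 1"
    and contour: "contour_around_origin \<gamma>"
  shows
    "(planar_orthogonal (planar_measure W) P \<longleftrightarrow>
        (\<forall>k<n. 1 / (2 * of_real pi * \<i>) *
           contour_integral \<gamma> (\<lambda>z. poly P z * poly W z * phi W k z) = 0)) \<and>
     (planar_orthogonal (planar_measure W) P \<longleftrightarrow>
        poly_diffop (conj_poly W) (\<lambda>z. poly P z * poly W z) \<in> O[at 0](\<lambda>z. z ^ n)) \<and>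
     (planar_orthogonal (planar_measure W) P \<longleftrightarrow>
        (\<exists>Q :: nat \<Rightarrow> complex poly. (\<forall>j\<in>{1..p}. degree (Q j) \<le> c j - 1) \<and>
           (\<lambda>z. poly P z * poly W z + (\<Sum>j=1..p. poly (Q j) z * exp (cnj (a j) * z)))
             \<in> O[at 0](\<lambda>z. z ^ (n + (\<Sum>j=1..p. c j)))))"
proof -
  define b where "b = (\<lambda>j. cnj (a j))"
  define f where "f = P * W"
  define F where "F = fps_of_poly f"
  have q: "conj_poly W = (\<Prod>j=1..p. [:- b j, 1:] ^ c j)"
    unfolding W b_def by (rule conj_poly_prod)
  have f: "(\<lambda>z. poly P z * poly W z) = poly f"
    by (simp add: f_def fun_eq_iff)
  have F: "poly f has_fps_expansion F"
    unfolding F_def by (rule poly_has_fps_expansion)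
  have orth: "planar_orthogonal (planar_measure W) P \<longleftrightarrow>
      (\<forall>k<n. fischer_moment (conj_poly W) f k = 0)"
    by (simp add: planar_orthogonal_def planar_moment P(1) f_def)
  have contour_iff: "(\<forall>k<n. 1 / (2 * of_real pi * \<i>) *
      contour_integral \<gamma> (\<lambda>z. poly P z * poly W z * phi W k z) = 0) \<longleftrightarrow>
      (\<forall>k<n. fischer_moment (conj_poly W) f k = 0)"
    using contour_moment[OF contour, of f W] by (simp add: f_def)
  have diffop: "(\<forall>k<n. fps_diffop (conj_poly W) F $ k = 0) \<longleftrightarrow>
      (\<forall>k<n. fischer_moment (conj_poly W) f k = 0)"
    unfolding F_def fps_diffop_nth_fps_of_poly[symmetric] by simp
  have diffop_bigo: "poly_diffop (conj_poly W) (poly f) \<in> O[at 0](\<lambda>z. z ^ n) \<longleftrightarrow>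
      (\<forall>k<n. fps_diffop (conj_poly W) F $ k = 0)"
    by (intro has_fps_expansion_bigo_iff has_fps_expansion_poly_diffop F)
  have exp_bigo: "(\<lambda>z. poly P z * poly W z + (\<Sum>j=1..p. poly (Q j) z * exp (cnj (a j) * z)))
        \<in> O[at 0](\<lambda>z. z ^ (n + (\<Sum>j=1..p. c j))) \<longleftrightarrow>
      (\<forall>k<n + sum c {1..p}. (F + exp_poly_fps {1..p} b Q) $ k = 0)" for Q
  proof -
    have "(\<lambda>z. poly f z + (\<Sum>j=1..p. poly (Q j) z * exp (b j * z)))
        has_fps_expansion F + exp_poly_fps {1..p} b Q"
      unfolding exp_poly_fps_def
      by (intro has_fps_expansion_add has_fps_expansion_sum has_fps_expansion_mult
          poly_has_fps_expansion has_fps_expansion_exp F)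
    from has_fps_expansion_bigo_iff[OF this] show ?thesis
      by (simp add: f_def b_def)
  qed
  \<comment> \<open>Positivity of \<open>c j\<close> enters here: for \<open>c j = 0\<close> the truncated bound \<open>c j - 1\<close> would admit constants.\<close>
  have degree: "degree r \<le> c j - 1 \<longleftrightarrow> (\<forall>k\<ge>c j. coeff r k = 0)" if "j \<in> {1..p}" for r :: "complex poly" and j
  proof
    assume "degree r \<le> c j - 1"
    then show "\<forall>k\<ge>c j. coeff r k = 0"
      using c_pos[OF that] by (auto intro!: coeff_eq_0)
  next
    assume "\<forall>k\<ge>c j. coeff r k = 0"
    then show "degree r \<le> c j - 1"
      by (intro degree_le) (use c_pos[OF that] in auto)
  qed
  then have degree_iff: "(\<forall>j\<in>{1..p}. degree (Q j) \<le> c j - 1) \<longleftrightarrow>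
      (\<forall>j\<in>{1..p}. \<forall>k\<ge>c j. coeff (Q j) k = 0)" for Q :: "nat \<Rightarrow> complex poly"
    by (intro ball_cong refl)
  have b_distinct: "inj_on b {1..p}"
    unfolding b_def using a_distinct by (metis (mono_tags, lifting) complex_cnj_cancel_iff inj_on_def)
  have exp_iff: "(\<forall>k<n. fps_diffop (conj_poly W) F $ k = 0) \<longleftrightarrow>
      (\<exists>Q. (\<forall>j\<in>{1..p}. degree (Q j) \<le> c j - 1) \<and>
        (\<forall>k<n + sum c {1..p}. (F + exp_poly_fps {1..p} b Q) $ k = 0))"
    unfolding q degree_iff
    by (rule fps_diffop_vanishes_iff[OF finite_atLeastAtMost b_distinct, of n c F])
  show ?thesis
    unfolding orth contour_iff exp_bigo exp_iff[symmetric] unfolding f diffop_bigo diffop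
    by (intro conjI refl)
qed

end
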